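(* Let $X$ be a real normed space and let $K\subset X$ be a convex body. Then for all $\mathbf{x}\in K$ we have $\sigma(K,\mathbf{x})=\beta(K,\mathbf{x})$.
   Context: $X$ is a real normed space, $X\neq\{0\}$, with unit sphere $S$. A convex body is a bounded, closed, convex set with nonempty interior. For $\mathbf{x}\in X$ let $\mathcal{L}=\mathcal{L}(K,\mathbf{x})$ be the set of straight lines $l=\{\mathbf{x}+t\mathbf{v}:t\in\mathbb{R}\}$, $\mathbf{v}\in S$, that meet $K$ in more than one point; for $l\in\mathcal{L}$ write $K\cap l=[\mathbf{a},\mathbf{b}]$, $\mathbf{a}\neq\mathbf{b}$, with endpoints labelled so that $\|\mathbf{x}-\mathbf{b}\|\le\|\mathbf{x}-\mathbf{a}\|$. Define $$\sigma(K,\mathbf{x})=\inf_{l\in\mathcal{L}}\frac{\|\mathbf{b}-\mathbf{x}\|}{\|\mathbf{a}-\mathbf{x}\|}\quad(\mathbf{x}\in X),\qquad \beta(K,\mathbf{x})=\sup\{\lambda\ge0:\ -\lambda(K-\mathbf{x})+\mathbf{x}\subset K\}\quad(\mathbf{x}\in K).$$ *)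

theory Defs
  imports "HOL-Analysis.Analysis"
begin

definition convex_body :: "'a::real_normed_vector set \<Rightarrow> bool" where
  "convex_body K \<longleftrightarrow> bounded K \<and> closed K \<and> convex K \<and> interior K \<noteq> {}"

definition chord_lines :: "'a::real_normed_vector set \<Rightarrow> 'a \<Rightarrow> 'a set set" where
  "chord_lines K x =
     {l. (\<exists>v \<in> sphere 0 1. l = {x + t *\<^sub>R v | t. t \<in> (UNIV :: real set)}) \<and>
         (\<exists>p \<in> K \<inter> l. \<exists>q \<in> K \<inter> l. p \<noteq> q)}"

(* For a convex body K, each chord line contributes exactly one ratio: K \<inter> l is a
   nondegenerate segment, its endpoints are unique up to order, and when both orders
   are admissible (x equidistant from the endpoints) the ratio is 1 either way.
   Moreover a \<noteq> b and norm (x - b) \<le> norm (x - a) force a \<noteq> x, so no division by 0 occurs. *)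
definition chord_sigma :: "'a::real_normed_vector set \<Rightarrow> 'a \<Rightarrow> real" where
  "chord_sigma K x =
     Inf {norm (b - x) / norm (a - x) | l a b.
            l \<in> chord_lines K x \<and> K \<inter> l = closed_segment a b \<and> a \<noteq> b \<and>
            norm (x - b) \<le> norm (x - a)}"

(* The supremum is meaningful for x \<in> K (then 0 belongs to the set) when K is bounded
   and K \<noteq> {x}. *)
definition reflect_beta :: "'a::real_normed_vector set \<Rightarrow> 'a \<Rightarrow> real" where
  "reflect_beta K x =
     Sup {c. c \<ge> 0 \<and> (\<lambda>y. (- c) *\<^sub>R (y - x) + x) ` K \<subseteq> K}"

end

theory Submission imports Defs begin

text \<open>
  Fix \<open>x \<in> K\<close>. Along a line through \<open>x\<close> the body is a segment \<open>[a, b]\<close> containing \<open>x\<close>, and in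
  the coordinate \<open>u\<close> with \<open>y = x + u (a - x)\<close> this segment is the interval \<open>[- r, 1]\<close>, where
  \<open>r = \<parallel>b - x\<parallel> / \<parallel>a - x\<parallel> \<le> 1\<close> is the ratio of the chord (\<open>chord_coordinates\<close>). The map
  \<open>y \<mapsto> x - c (y - x)\<close> preserves every line through \<open>x\<close> and acts on it as \<open>u \<mapsto> - c u\<close>.
  Therefore both quantities can be compared chord by chord.

  If the map sends \<open>K\<close> into itself, then it sends \<open>a\<close>, with coordinate \<open>1\<close>, to a point of the
  chord with coordinate \<open>- c\<close>, which forces \<open>c \<le> r\<close>
  (\<open>reflection_factor_le_chord_ratio\<close>). Conversely, a factor \<open>c \<le> r\<close> maps \<open>[- r, 1]\<close> into
  \<open>[- c, c r]\<close>, which lies in \<open>[- r, 1]\<close> because \<open>r \<le> 1\<close>; so the infimum of all the ratios is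
  itself an admissible factor (\<open>reflection_in_chord\<close>). This infimum is thus the largest
  admissible factor. Since every point of \<open>K\<close> other than \<open>x\<close> lies on a chord through \<open>x\<close>
  (\<open>chord_through\<close>), no part of \<open>K\<close> is missed.
\<close>

section \<open>Coordinates on a chord\<close>

lemma closed_segment_on_line:
  fixes x v :: "'a::real_normed_vector" and c d :: real
  assumes "c \<le> d"
  shows "closed_segment (x + c *\<^sub>R v) (x + d *\<^sub>R v) = (\<lambda>t. x + t *\<^sub>R v) ` {c..d}"
proof -
  have "linear (\<lambda>t. t *\<^sub>R v)"
    by (simp add: linear_iff scaleR_add_left)
  from closed_segment_linear_image[OF this, of c d]
  have "closed_segment (c *\<^sub>R v) (d *\<^sub>R v) = (\<lambda>t. t *\<^sub>R v) ` {c..d}"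
    using assms by (simp add: closed_segment_eq_real_ivl)
  then show ?thesis
    by (simp add: closed_segment_translation image_image)
qed

lemma chord_coordinates:
  fixes x a b :: "'a::real_normed_vector"
  assumes x: "x \<in> closed_segment a b" and ab: "a \<noteq> b"
    and le: "norm (x - b) \<le> norm (x - a)"
  defines "r \<equiv> norm (b - x) / norm (a - x)"
  shows "a \<noteq> x" and "0 \<le> r" and "r \<le> 1"
    and "closed_segment a b = (\<lambda>u. x + u *\<^sub>R (a - x)) ` {- r..1}"
proof -
  show ax: "a \<noteq> x"
    using ab le by auto
  show r0: "0 \<le> r"
    by (simp add: r_def)
  show "r \<le> 1"
    using le ax by (simp add: r_def norm_minus_commute)
  obtain s where s: "0 \<le> s" "s \<le> 1" and xs: "x = (1 - s) *\<^sub>R a + s *\<^sub>R b"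
    using x by (auto simp: in_segment)
  have bx: "b - x = (1 - s) *\<^sub>R (b - a)" and a_x: "a - x = (- s) *\<^sub>R (b - a)"
    by (simp_all add: xs algebra_simps)
  have "s \<noteq> 0"
    using ax a_x by auto
  have "norm (b - x) = (1 - s) * norm (b - a)" "norm (a - x) = s * norm (b - a)"
    unfolding bx a_x using s by auto
  then have "r = (1 - s) / s"
    using ab by (simp add: r_def)
  then have "r * s = 1 - s"
    using \<open>s \<noteq> 0\<close> by simp
  then have "b - x = (- r) *\<^sub>R (a - x)"
    unfolding bx a_x scaleR_scaleR by simp
  then have b: "x + (- r) *\<^sub>R (a - x) = b"
    by (simp only: diff_eq_eq add.commute[of x])
  have "closed_segment a b = closed_segment b a"
    by (rule closed_segment_commute)
  also have "\<dots> = closed_segment (x + (- r) *\<^sub>R (a - x)) (x + 1 *\<^sub>R (a - x))"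
    using b by simp
  also have "\<dots> = (\<lambda>u. x + u *\<^sub>R (a - x)) ` {- r..1}"
    by (rule closed_segment_on_line) (use r0 in simp)
  finally show "closed_segment a b = (\<lambda>u. x + u *\<^sub>R (a - x)) ` {- r..1}" .
qed

section \<open>Chords of a bounded closed convex set\<close>

text \<open>
  The parameters \<open>t\<close> with \<open>x + t v \<in> K\<close> form a compact interval of the real line, even
  though \<open>K\<close> itself need not be compact. This makes the intersection with the line a segment.
\<close>

lemma line_section_is_segment:
  fixes K :: "'a::real_normed_vector set"
  assumes K: "bounded K" "closed K" "convex K" and x: "x \<in> K" and v: "norm v = 1"
  obtains c d :: real where "c \<le> d"
    "K \<inter> {x + t *\<^sub>R v | t. t \<in> UNIV} = closed_segment (x + c *\<^sub>R v) (x + d *\<^sub>R v)"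
proof -
  define T where "T = (\<lambda>t. x + t *\<^sub>R v) -` K"
  have "closed T"
    unfolding T_def by (intro continuous_closed_vimage K continuous_intros)
  obtain B where B: "\<And>y. y \<in> K \<Longrightarrow> norm y \<le> B"
    using K(1) by (auto simp: bounded_iff)
  have "\<bar>t\<bar> \<le> B + norm x" if "t \<in> T" for t
  proof -
    have "\<bar>t\<bar> = norm ((x + t *\<^sub>R v) - x)"
      using v by simp
    also have "\<dots> \<le> norm (x + t *\<^sub>R v) + norm x"
      by (rule norm_triangle_ineq4)
    also have "\<dots> \<le> B + norm x"
      using that B by (simp add: T_def)
    finally show ?thesis .
  qed
  then have "bounded T"
    by (auto simp: bounded_iff)
  have "convex T"
  proof (rule convexI)
    fix p q \<alpha> \<gamma> :: real
    assume pq: "p \<in> T" "q \<in> T" and w: "0 \<le> \<alpha>" "0 \<le> \<gamma>" "\<alpha> + \<gamma> = 1"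
    have "\<alpha> *\<^sub>R (x + p *\<^sub>R v) + \<gamma> *\<^sub>R (x + q *\<^sub>R v)
        = (\<alpha> + \<gamma>) *\<^sub>R x + (\<alpha> * p + \<gamma> * q) *\<^sub>R v"
      by (simp add: algebra_simps)
    then show "\<alpha> *\<^sub>R p + \<gamma> *\<^sub>R q \<in> T"
      using convexD[OF K(3), of "x + p *\<^sub>R v" "x + q *\<^sub>R v" \<alpha> \<gamma>] pq w by (simp add: T_def)
  qed
  then obtain c d where T: "T = {c..d}"
    using connected_compact_interval_1[of T] \<open>closed T\<close> \<open>bounded T\<close>
    by (auto simp: compact_eq_bounded_closed convex_connected)
  moreover have "0 \<in> T"
    using x by (simp add: T_def)
  ultimately have cd: "c \<le> d"
    by simp
  have "K \<inter> {x + t *\<^sub>R v | t. t \<in> UNIV} = (\<lambda>t. x + t *\<^sub>R v) ` T"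
    by (auto simp: T_def)
  also have "\<dots> = closed_segment (x + c *\<^sub>R v) (x + d *\<^sub>R v)"
    by (simp add: T closed_segment_on_line[OF cd])
  finally show thesis
    by (rule that[OF cd])
qed

lemma chord_through:
  fixes K :: "'a::real_normed_vector set"
  assumes K: "bounded K" "closed K" "convex K" and x: "x \<in> K" and y: "y \<in> K" "y \<noteq> x"
  obtains l a b where "l \<in> chord_lines K x" "K \<inter> l = closed_segment a b" "a \<noteq> b"
    "norm (x - b) \<le> norm (x - a)" "x \<in> closed_segment a b" "y \<in> closed_segment a b"
proof -
  define v where "v = (1 / norm (y - x)) *\<^sub>R (y - x)"
  define l where "l = {x + t *\<^sub>R v | t. t \<in> (UNIV :: real set)}"
  have v: "norm v = 1"
    using y by (simp add: v_def)
  obtain c d where seg: "K \<inter> l = closed_segment (x + c *\<^sub>R v) (x + d *\<^sub>R v)"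
    by (rule line_section_is_segment[OF K x v, folded l_def])
  have on_line: "x + t *\<^sub>R v \<in> l" for t
    unfolding l_def by blast
  have xy: "x \<in> K \<inter> l" "y \<in> K \<inter> l"
    using x y on_line[of 0] on_line[of "norm (y - x)"] by (simp_all add: v_def)
  have l: "l \<in> chord_lines K x"
    unfolding chord_lines_def
  proof (intro CollectI conjI)
    show "\<exists>v\<in>sphere 0 1. l = {x + t *\<^sub>R v | t. t \<in> (UNIV :: real set)}"
      using v l_def by (intro bexI[of _ v]) auto
    show "\<exists>p\<in>K \<inter> l. \<exists>q\<in>K \<inter> l. p \<noteq> q"
      using xy y(2) by blast
  qed
  have ne: "p \<noteq> q" if "K \<inter> l = closed_segment p q" for p q
    using xy y(2) that by auto
  let ?p = "x + c *\<^sub>R v" and ?q = "x + d *\<^sub>R v"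
  show thesis
  proof (cases "norm (x - ?q) \<le> norm (x - ?p)")
    case True
    then show thesis
      using that[OF l seg ne[OF seg]] xy unfolding seg by blast
  next
    case False
    have seg': "K \<inter> l = closed_segment ?q ?p"
      using seg by (simp add: closed_segment_commute)
    show thesis
      using that[OF l seg' ne[OF seg']] xy False unfolding seg' by simp
  qed
qed

text \<open>
  A convex body has a point besides \<open>x\<close>, so there is at least one chord through \<open>x\<close> and
  the infimum of the ratios is taken over a nonempty set.
\<close>

lemma interior_nonempty_imp_other_point:
  fixes K :: "'a::real_normed_vector set"
  assumes "(UNIV :: 'a set) \<noteq> {0}" and "interior K \<noteq> {}"
  obtains y where "y \<in> K" "y \<noteq> x"
proof -
  obtain w :: 'a where w: "w \<noteq> 0"
    using assms(1) by blast
  obtain z e where e: "e > 0" "ball z e \<subseteq> K"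
    using assms(2) by (auto simp: mem_interior)
  define z' where "z' = z + (e / 2 / norm w) *\<^sub>R w"
  have "z' \<in> ball z e" "z' \<noteq> z"
    using e w by (simp_all add: z'_def dist_norm)
  then show thesis
    using that e by (metis centre_in_ball subsetD)
qed

section \<open>Reflection factors and chord ratios\<close>

lemma reflection_factor_le_chord_ratio:
  fixes K :: "'a::real_normed_vector set"
  assumes seg: "K \<inter> l = closed_segment a b" and l: "l \<in> chord_lines K x" and x: "x \<in> K"
    and ab: "a \<noteq> b" and le: "norm (x - b) \<le> norm (x - a)"
    and c: "(\<lambda>y. (- c) *\<^sub>R (y - x) + x) ` K \<subseteq> K"
  shows "c \<le> norm (b - x) / norm (a - x)"
proof -
  obtain v where lv: "l = {x + t *\<^sub>R v | t. t \<in> (UNIV :: real set)}"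
    using l unfolding chord_lines_def by auto
  have on_line: "x + t *\<^sub>R v \<in> l" for t
    unfolding lv by blast
  have "x \<in> l"
    using on_line[of 0] by simp
  then have xs: "x \<in> closed_segment a b"
    using seg x by auto
  note coords = chord_coordinates[OF xs ab le]
  have "a \<in> K \<inter> l"
    unfolding seg by simp
  then obtain t where "a = x + t *\<^sub>R v"
    unfolding lv by auto
  then have "(- c) *\<^sub>R (a - x) + x = x + (- c * t) *\<^sub>R v"
    by simp
  then have "(- c) *\<^sub>R (a - x) + x \<in> l"
    using on_line by metis
  moreover have "(- c) *\<^sub>R (a - x) + x \<in> K"
    using c \<open>a \<in> K \<inter> l\<close> by blast
  ultimately have "(- c) *\<^sub>R (a - x) + x \<in> closed_segment a b"
    using seg by blast
  then obtain u where u: "u \<in> {- (norm (b - x) / norm (a - x))..1}"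
    "(- c) *\<^sub>R (a - x) + x = x + u *\<^sub>R (a - x)"
    unfolding coords(4) by auto
  then have "(- c) *\<^sub>R (a - x) = u *\<^sub>R (a - x)"
    by (simp add: add.commute)
  then have "- c = u"
    using coords(1) unfolding scaleR_cancel_right by simp
  then show ?thesis
    using u by auto
qed

text \<open>
  A point between \<open>x\<close> and the far endpoint \<open>a\<close> is reflected towards \<open>b\<close>, where \<open>c \<le> r\<close>
  keeps it inside; a point on the side of \<open>b\<close> is reflected towards \<open>a\<close>, where there is room
  because \<open>b\<close> is the nearer endpoint.
\<close>

lemma reflection_in_chord:
  fixes x y a b :: "'a::real_normed_vector"
  assumes x: "x \<in> closed_segment a b" and y: "y \<in> closed_segment a b" and ab: "a \<noteq> b"
    and le: "norm (x - b) \<le> norm (x - a)"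
    and c: "0 \<le> c" "c \<le> norm (b - x) / norm (a - x)"
  shows "(- c) *\<^sub>R (y - x) + x \<in> closed_segment a b"
proof -
  define r where "r = norm (b - x) / norm (a - x)"
  note coords = chord_coordinates[OF x ab le, folded r_def]
  obtain u where u: "- r \<le> u" "u \<le> 1" and yu: "y = x + u *\<^sub>R (a - x)"
    using y unfolding coords(4) by auto
  have "c * u \<le> c * 1"
    using u c by (intro mult_left_mono) auto
  moreover have "c * (- u) \<le> 1 * 1"
  proof (cases "u \<le> 0")
    case True
    then show ?thesis
      using u c coords(3) unfolding r_def[symmetric] by (intro mult_mono) auto
  next
    case False
    then have "0 \<le> c * u"
      using c by simp
    then show ?thesis
      by simp
  qed
  ultimately have "- (c * u) \<in> {- r..1}"
    using c unfolding r_def[symmetric] by auto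
  moreover have "(- c) *\<^sub>R (y - x) + x = x + (- (c * u)) *\<^sub>R (a - x)"
    by (simp add: yu)
  ultimately show ?thesis
    unfolding coords(4) by blast
qed

theorem proposition4p7:
  fixes K :: "'a::real_normed_vector set"
  assumes "(UNIV :: 'a set) \<noteq> {0}"
    and "convex_body K"
  shows "\<forall>x \<in> K. chord_sigma K x = reflect_beta K x"
proof
  fix x assume x: "x \<in> K"
  have K: "bounded K" "closed K" "convex K" "interior K \<noteq> {}"
    using assms(2) by (auto simp: convex_body_def)
  define R where "R = {norm (b - x) / norm (a - x) | l a b.
            l \<in> chord_lines K x \<and> K \<inter> l = closed_segment a b \<and> a \<noteq> b \<and>
            norm (x - b) \<le> norm (x - a)}"
  define C where "C = {c. c \<ge> 0 \<and> (\<lambda>y. (- c) *\<^sub>R (y - x) + x) ` K \<subseteq> K}"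
  obtain y where "y \<in> K" "y \<noteq> x"
    using interior_nonempty_imp_other_point[OF assms(1) K(4)] .
  then obtain l a b where "l \<in> chord_lines K x" "K \<inter> l = closed_segment a b" "a \<noteq> b"
    "norm (x - b) \<le> norm (x - a)"
    using chord_through[OF K(1-3) x] by metis
  then have "R \<noteq> {}"
    unfolding R_def by blast
  have nonneg: "0 \<le> r" if "r \<in> R" for r
    using that by (auto simp: R_def)
  then have "bdd_below R"
    by (meson bdd_belowI)
  have Inf0: "0 \<le> Inf R"
    using \<open>R \<noteq> {}\<close> nonneg by (rule cInf_greatest)
  have reflected: "(- Inf R) *\<^sub>R (y - x) + x \<in> K" if y: "y \<in> K" for y
  proof (cases "y = x")
    case True
    then show ?thesis
      using x by simp
  next
    case False
    obtain l a b where *: "l \<in> chord_lines K x" "K \<inter> l = closed_segment a b" "a \<noteq> b"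
      "norm (x - b) \<le> norm (x - a)" "x \<in> closed_segment a b" "y \<in> closed_segment a b"
      using chord_through[OF K(1-3) x y False] .
    then have "norm (b - x) / norm (a - x) \<in> R"
      unfolding R_def by blast
    then have "Inf R \<le> norm (b - x) / norm (a - x)"
      using \<open>bdd_below R\<close> by (rule cInf_lower)
    then have "(- Inf R) *\<^sub>R (y - x) + x \<in> closed_segment a b"
      using reflection_in_chord[OF *(5,6,3,4) Inf0] by blast
    then show ?thesis
      using *(2) by blast
  qed
  have "Sup C = Inf R"
  proof (rule cSup_eq_maximum)
    show "Inf R \<in> C"
      using Inf0 reflected unfolding C_def by blast
  next
    fix c assume c: "c \<in> C"
    show "c \<le> Inf R"
    proof (rule cInf_greatest[OF \<open>R \<noteq> {}\<close>])
      fix r assume "r \<in> R"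
      then show "c \<le> r"
        using c reflection_factor_le_chord_ratio[OF _ _ x] unfolding R_def C_def by blast
    qed
  qed
  then show "chord_sigma K x = reflect_beta K x"
    by (simp add: chord_sigma_def reflect_beta_def R_def C_def)
qed

end
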